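(* Suppose $G$ and $\boldsymbol d$ satisfy assumptions (a), (c), (d) of the context. Let $Q(G)$ be the signless Laplacian of $G$ and define $\boldsymbol\beta$ by $$\beta_j:=\tfrac12\log\frac{\lambda}{1-\lambda}+\gamma_j,\qquad \boldsymbol\gamma=(\gamma_1,\dots,\gamma_n)^{\mathsf T}:=\Lambda^{-1}Q(G)^{-1}(\boldsymbol d-\lambda\boldsymbol g).$$ Suppose $$\|\boldsymbol d-\lambda\boldsymbol g\|_\infty=O(\Lambda^{3/4}n^{3/4-\sigma/4})\quad\text{and}\quad \|\boldsymbol d-\lambda\boldsymbol g\|_2=O(\Lambda^{1/2}n^{1+\varepsilon/2}).$$ Then $\boldsymbol\beta$ satisfies assumptions (b) and (e) of the context, with $$\|\boldsymbol\delta\|_\infty=O(\Lambda^{-1}n^{-1})\,\|\boldsymbol d-\lambda\boldsymbol g\|_\infty^2\quad\text{and}\quad \|\boldsymbol\delta\|_1=O(\Lambda^{-1}n^{-1})\,\|\boldsymbol d-\lambda\boldsymbol g\|_2^2 .$$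
   Context: All graphs are labelled and simple. $G$ is a graph with vertex set $[n]$ and degree sequence $\boldsymbol g=(g_1,\dots,g_n)$; $jk\in G$ means $\{j,k\}\in E(G)$. $\boldsymbol d=(d_1,\dots,d_n)$ is a positive integer sequence with even sum. For $\boldsymbol\beta\in\mathbb R^n$, $\lambda_{jk}=\lambda_{jk}(\boldsymbol\beta)=\frac{e^{\beta_j+\beta_k}}{1+e^{\beta_j+\beta_k}}$, and $\boldsymbol\delta=(\delta_1,\dots,\delta_n)$ with $\delta_j=\sum_{k:jk\in G}\lambda_{jk}-d_j$. Also $\lambda=\frac{\sum_jd_j}{\sum_jg_j}$ and $\Lambda=\lambda(1-\lambda)$. The signless Laplacian $Q(G)$ has diagonal entries $g_j$, entries $1$ where $jk\in G$, and $0$ otherwise; $q(G)$ is its least eigenvalue. The Cheeger constant is $h(G)=\min_{1\le|U|\le n/2}|\partial_GU|/|U|$, where $\partial_GU$ is the set of edges with exactly one end in $U\subseteq[n]$. Assumptions, with positive constants $\sigma,B,C,\tau_Q$ and sufficiently small $\varepsilon>0$: (a) $d_j\le g_j$ for all $j\in[n]$; (b) $|\beta_j-\beta_k|\le C$ for all $j,k\in[n]$; (c) $\Lambda\ge Bn^{\sigma-1}$; (d) $h(G)\ge\Lambda^{-1}\log^2n$ and $q(G)\ge\tau_Qn$; (e) $\|\boldsymbol\delta\|_\infty=O(\Lambda^{1/2}n^{1/2-\sigma/2})$ and $\|\boldsymbol\delta\|_1=O(n^{1+\varepsilon})$. (In the conclusion, (b) means that it holds for some constant $C$.) Asymptotics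 are for $n\to\infty$; implied constants in $O(\cdot)$ depend only on the constants of the assumptions and $\varepsilon$ (and on the implied constants in the hypotheses), and bounds hold for all sufficiently large $n$ and sufficiently small $\varepsilon>0$. *)

theory Defs
  imports
    "HOL-Analysis.L2_Norm"
    "Jordan_Normal_Form.Spectral_Radius"
    "Jordan_Normal_Form.Gauss_Jordan_Elimination"
begin

text \<open>A graph of order \<open>n\<close> is given by its set of edges, which are 2-element sets of vertices.
  Vertices are numbered from 0, to agree with the indexing of matrices and vectors.
  Sequences of length \<open>n\<close> are functions on \<open>nat\<close> of which only the values below \<open>n\<close> matter.\<close>

definition simple_graph :: "nat \<Rightarrow> nat set set \<Rightarrow> bool" where
  "simple_graph n E \<longleftrightarrow> E \<subseteq> {{j, k} | j k. j < n \<and> k < n \<and> j \<noteq> k}"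

definition deg :: "nat \<Rightarrow> nat set set \<Rightarrow> nat \<Rightarrow> nat" where
  "deg n E j = card {k. k < n \<and> {j, k} \<in> E}"

definition edge_boundary :: "nat set set \<Rightarrow> nat set \<Rightarrow> nat set set" where
  "edge_boundary E U = {e \<in> E. card (e \<inter> U) = 1}"

text \<open>For \<open>n < 2\<close> the minimum is over the empty set; only large \<open>n\<close> matter.\<close>

definition cheeger :: "nat \<Rightarrow> nat set set \<Rightarrow> real" where
  "cheeger n E = Min ((\<lambda>U. real (card (edge_boundary E U)) / real (card U)) `
     {U. U \<subseteq> {..<n} \<and> 1 \<le> card U \<and> real (card U) \<le> real n / 2})"

definition signless_laplacian :: "nat \<Rightarrow> nat set set \<Rightarrow> real mat" where
  "signless_laplacian n E = mat n n (\<lambda>(j, k).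
     if j = k then real (deg n E j) else if {j, k} \<in> E then 1 else 0)"

definition least_eigenvalue :: "real mat \<Rightarrow> real" where
  "least_eigenvalue A = Min (spectrum A)"

definition pos_even_seq :: "nat \<Rightarrow> (nat \<Rightarrow> nat) \<Rightarrow> bool" where
  "pos_even_seq n d \<longleftrightarrow> (\<forall>j<n. 0 < d j) \<and> even (\<Sum>j<n. d j)"

definition density :: "nat \<Rightarrow> nat set set \<Rightarrow> (nat \<Rightarrow> nat) \<Rightarrow> real" where
  "density n E d = real (\<Sum>j<n. d j) / real (\<Sum>j<n. deg n E j)"

definition Lam :: "nat \<Rightarrow> nat set set \<Rightarrow> (nat \<Rightarrow> nat) \<Rightarrow> real" where
  "Lam n E d = density n E d * (1 - density n E d)"

definition edge_prob :: "(nat \<Rightarrow> real) \<Rightarrow> nat \<Rightarrow> nat \<Rightarrow> real" where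
  "edge_prob \<beta> j k = exp (\<beta> j + \<beta> k) / (1 + exp (\<beta> j + \<beta> k))"

definition discrepancy ::
    "nat \<Rightarrow> nat set set \<Rightarrow> (nat \<Rightarrow> nat) \<Rightarrow> (nat \<Rightarrow> real) \<Rightarrow> nat \<Rightarrow> real" where
  "discrepancy n E d \<beta> j = (\<Sum>k\<in>{k. k < n \<and> {j, k} \<in> E}. edge_prob \<beta> j k) - real (d j)"

definition norm_inf :: "nat \<Rightarrow> (nat \<Rightarrow> real) \<Rightarrow> real" where
  "norm_inf n x = Max ((\<lambda>j. \<bar>x j\<bar>) ` {..<n})"

definition norm_1 :: "nat \<Rightarrow> (nat \<Rightarrow> real) \<Rightarrow> real" where
  "norm_1 n x = (\<Sum>j<n. \<bar>x j\<bar>)"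

definition norm_2 :: "nat \<Rightarrow> (nat \<Rightarrow> real) \<Rightarrow> real" where
  "norm_2 n x = L2_set x {..<n}"

definition deviation :: "nat \<Rightarrow> nat set set \<Rightarrow> (nat \<Rightarrow> nat) \<Rightarrow> nat \<Rightarrow> real" where
  "deviation n E d j = real (d j) - density n E d * real (deg n E j)"

text \<open>The value of \<open>the (mat_inverse Q)\<close> is meaningful only for invertible \<open>Q\<close>, which is
  guaranteed when the least eigenvalue of the signless Laplacian is positive.\<close>

definition gamma_vec :: "nat \<Rightarrow> nat set set \<Rightarrow> (nat \<Rightarrow> nat) \<Rightarrow> real vec" where
  "gamma_vec n E d = (1 / Lam n E d) \<cdot>\<^sub>v
     (the (mat_inverse (signless_laplacian n E)) *\<^sub>v vec n (deviation n E d))"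

definition beta :: "nat \<Rightarrow> nat set set \<Rightarrow> (nat \<Rightarrow> nat) \<Rightarrow> nat \<Rightarrow> real" where
  "beta n E d j = 1/2 * ln (density n E d / (1 - density n E d)) + gamma_vec n E d $ j"

definition degrees_bounded :: "nat \<Rightarrow> nat set set \<Rightarrow> (nat \<Rightarrow> nat) \<Rightarrow> bool" where
  "degrees_bounded n E d \<longleftrightarrow> (\<forall>j<n. d j \<le> deg n E j)"

definition spread_bounded :: "real \<Rightarrow> nat \<Rightarrow> (nat \<Rightarrow> real) \<Rightarrow> bool" where
  "spread_bounded C n \<beta> \<longleftrightarrow> (\<forall>j<n. \<forall>k<n. \<bar>\<beta> j - \<beta> k\<bar> \<le> C)"

definition dense_enough ::
    "real \<Rightarrow> real \<Rightarrow> nat \<Rightarrow> nat set set \<Rightarrow> (nat \<Rightarrow> nat) \<Rightarrow> bool" where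
  "dense_enough \<sigma> B n E d \<longleftrightarrow> Lam n E d \<ge> B * real n powr (\<sigma> - 1)"

definition expanding :: "real \<Rightarrow> nat \<Rightarrow> nat set set \<Rightarrow> (nat \<Rightarrow> nat) \<Rightarrow> bool" where
  "expanding \<tau> n E d \<longleftrightarrow>
     cheeger n E \<ge> 1 / Lam n E d * (ln (real n))^2 \<and>
     least_eigenvalue (signless_laplacian n E) \<ge> \<tau> * real n"

text \<open>\<open>K\<close> and \<open>L\<close> are the implied constants of the two \<open>O\<close>-bounds.\<close>

definition discrepancy_small ::
    "real \<Rightarrow> real \<Rightarrow> real \<Rightarrow> real \<Rightarrow> nat \<Rightarrow> nat set set \<Rightarrow> (nat \<Rightarrow> nat) \<Rightarrow> (nat \<Rightarrow> real) \<Rightarrow> bool" where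
  "discrepancy_small \<sigma> \<epsilon> K L n E d \<beta> \<longleftrightarrow>
     norm_inf n (discrepancy n E d \<beta>) \<le> K * (Lam n E d powr (1/2) * real n powr (1/2 - \<sigma>/2)) \<and>
     norm_1 n (discrepancy n E d \<beta>) \<le> L * real n powr (1 + \<epsilon>)"

end

theory Submission
  imports Defs "HOL-Analysis.Function_Topology"
begin

text \<open>Write \<open>x = d - \<lambda>g\<close> and \<open>y = Q\<inverse>x\<close>, so that \<open>\<gamma> = \<Lambda>\<inverse>y\<close>. Since the quadratic form
  of \<open>Q\<close> is at least \<open>\<tau>n\<close> times the squared norm, \<open>y\<close> has 2-norm at most that of \<open>x\<close> over \<open>\<tau>n\<close>.
  Testing the form on unit vectors gives \<open>g\<^sub>j \<ge> \<tau>n\<close>, so solving row \<open>j\<close> of \<open>Qy = x\<close> for \<open>y\<^sub>j\<close>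
  and applying Cauchy-Schwarz to the remaining entries also bounds the maximum norm of \<open>y\<close> by
  \<open>O(1/n)\<close> times that of \<open>x\<close>. In the expansion of \<open>\<lambda>\<^sub>j\<^sub>k\<close> in powers of \<open>\<gamma>\<^sub>j + \<gamma>\<^sub>k\<close> the
  constant and linear terms sum to \<open>d\<^sub>j\<close>, leaving \<open>\<delta>\<^sub>j\<close> of order \<open>\<Lambda> \<Sum>\<^sub>k (\<gamma>\<^sub>j + \<gamma>\<^sub>k)\<^sup>2\<close>.\<close>

section \<open>Least eigenvalue and quadratic form of a symmetric matrix\<close>

text \<open>For small \<open>t\<close> of sign opposite to \<open>c\<close> the linear term
  dominates: \<open>t = - e * c\<close> with \<open>e * \<bar>r\<bar> \<le> 1\<close> makes the
  value negative. This is the first-order condition at a minimum.\<close>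

lemma nonneg_quadratic_imp_linear_coeff_0:
  fixes c r :: real
  assumes "\<And>t. 0 \<le> 2 * t * c + t\<^sup>2 * r"
  shows "c = 0"
proof (rule ccontr)
  assume "c \<noteq> 0"
  define e where "e = 1 / (\<bar>r\<bar> + 1)"
  have e: "e > 0" "e * \<bar>r\<bar> \<le> 1" by (auto simp: e_def field_simps)
  have "0 \<le> 2 * (- e * c) * c + (- e * c)\<^sup>2 * r" by (rule assms)
  also have "\<dots> = e * c\<^sup>2 * (e * r - 2)" by (simp add: power2_eq_square algebra_simps)
  finally have *: "0 \<le> e * c\<^sup>2 * (e * r - 2)" .
  have "e * r \<le> e * \<bar>r\<bar>" using e by (intro mult_left_mono) auto
  then have "e * r - 2 < 0" using e by linarith
  moreover have "e * c\<^sup>2 > 0" using e \<open>c \<noteq> 0\<close> by simp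
  ultimately have "e * c\<^sup>2 * (e * r - 2) < 0" by (rule mult_pos_neg[rotated])
  with * show False by simp
qed

text \<open>The witness \<open>u\<close> minimises the form on the unit sphere; stationarity in the direction of the
  residual \<open>w = a u - m u\<close> forces \<open>w = 0\<close>.\<close>

lemma symmetric_form_minimum_eigenvector:
  fixes a :: "nat \<Rightarrow> nat \<Rightarrow> real"
  assumes "n > 0" and sym: "\<And>i j. i < n \<Longrightarrow> j < n \<Longrightarrow> a i j = a j i"
  obtains u m where
    "\<exists>i<n. u i \<noteq> 0"
    "\<And>i. i < n \<Longrightarrow> (\<Sum>j<n. a i j * u j) = m * u i"
    "\<And>v. m * (\<Sum>i<n. (v i)\<^sup>2) \<le> (\<Sum>i<n. \<Sum>j<n. a i j * v i * v j)"
proof -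
  define b where "b = (\<lambda>x y :: nat \<Rightarrow> real. \<Sum>i<n. \<Sum>j<n. a i j * x i * y j)"
  define s where "s = (\<lambda>v :: nat \<Rightarrow> real. \<Sum>i<n. (v i)\<^sup>2)"
  \<comment> \<open>Vectors are functions on all of \<open>nat\<close>, so coordinates from
    \<open>n\<close> on are pinned to 0. The cube is then compact in the product topology, and
    \<open>K\<close> is a copy of the unit sphere of dimension \<open>n - 1\<close>.\<close>
  define S where "S = (\<lambda>i :: nat. if i < n then {-1..1} else {0 :: real})"
  define K where "K = PiE UNIV S \<inter> {v. s v = 1}"
  have "compactin (product_topology (\<lambda>_. euclidean) UNIV) (PiE UNIV S)"
    by (simp add: compactin_PiE S_def)
  then have "compact (PiE UNIV S)" by (simp add: euclidean_product_topology)
  moreover have "closed {v. s v = 1}"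
    unfolding s_def by (intro closed_Collect_eq continuous_intros) auto
  ultimately have "compact K" unfolding K_def by (rule compact_Int_closed)
  moreover have "(\<lambda>i. if i = 0 then 1 else 0) \<in> K"
    using \<open>n > 0\<close> by (auto simp: K_def S_def s_def if_distrib[of "\<lambda>x. x\<^sup>2"] cong: if_cong)
  moreover have "continuous_on K (\<lambda>v. b v v)"
    unfolding b_def
    by (intro continuous_intros continuous_on_subset[OF continuous_on_product_coordinates]) auto
  ultimately obtain u where u: "u \<in> K" "\<And>v. v \<in> K \<Longrightarrow> b u u \<le> b v v"
    using continuous_attains_inf[of K "\<lambda>v. b v v"] by blast
  define m where "m = b u u"
  have su: "s u = 1" using u(1) by (simp add: K_def)
  \<comment> \<open>Both sides are homogeneous of degree 2, so the minimum over the sphere extends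
    to every \<open>v\<close>. The normalised vector is cut off at \<open>n\<close> in order to lie
    in \<open>K\<close>.\<close>
  have min: "m * s v \<le> b v v" for v
  proof (cases "s v = 0")
    case True
    then have "v i = 0" if "i < n" for i
      using that by (simp add: s_def sum_nonneg_eq_0_iff)
    then show ?thesis using True by (simp add: b_def)
  next
    case False
    then have pos: "s v > 0" by (simp add: s_def sum_nonneg order_less_le)
    define w where "w = (\<lambda>i. if i < n then v i / sqrt (s v) else 0)"
    have sw: "s w = 1"
      using pos by (simp add: s_def w_def power_divide flip: sum_divide_distrib)
    have "\<bar>w i\<bar> \<le> 1" if "i < n" for i
    proof -
      have "(w i)\<^sup>2 \<le> s w" unfolding s_def using that
        by (intro member_le_sum) auto
      then show ?thesis using sw by (simp add: abs_square_le_1)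
    qed
    moreover have "w i = 0" if "\<not> i < n" for i using that by (simp add: w_def)
    ultimately have "w i \<in> S i" for i
      by (cases "i < n") (auto simp: S_def abs_le_iff minus_le_iff)
    then have "w \<in> K" using sw by (simp add: K_def PiE_def Pi_def)
    then have "m \<le> b w w" unfolding m_def by (rule u)
    also have "b w w = b v v / s v"
    proof -
      have "b w w = (\<Sum>i<n. \<Sum>j<n. a i j * v i * v j / s v)"
        unfolding b_def using pos
        by (intro sum.cong refl) (simp add: w_def field_simps)
      then show ?thesis by (simp add: b_def sum_divide_distrib)
    qed
    finally show ?thesis using pos by (simp add: field_simps)
  qed
  define w where "w = (\<lambda>i. (\<Sum>j<n. a i j * u j) - m * u i)"
  have "s w = 0"
  proof (rule nonneg_quadratic_imp_linear_coeff_0)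
    fix t
    let ?v = "\<lambda>i. u i + t * w i"
    have bs: "b u w = b w u"
      unfolding b_def using sym by (subst sum.swap) (auto intro!: sum.cong)
    have b: "b ?v ?v = b u u + t * (b u w + b w u) + t\<^sup>2 * b w w"
      by (simp add: b_def sum.distrib sum_distrib_left algebra_simps power2_eq_square)
    have s: "s ?v = s u + 2 * t * (\<Sum>i<n. u i * w i) + t\<^sup>2 * s w"
      by (simp add: s_def sum.distrib sum_distrib_left algebra_simps power2_eq_square)
    have bwu: "b w u = s w + m * (\<Sum>i<n. u i * w i)"
    proof -
      have "s w = (\<Sum>i<n. w i * (\<Sum>j<n. a i j * u j) - m * (u i * w i))"
        unfolding s_def power2_eq_square by (subst (2) w_def) (simp add: algebra_simps)
      then show ?thesis
        by (simp add: b_def sum_subtractf sum_distrib_left algebra_simps)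
    qed
    \<comment> \<open>The terms of order zero both equal \<open>m\<close> and cancel; by
      \<open>bwu\<close> the terms in \<open>\<Sum>i<n. u i * w i\<close> cancel too, which leaves
      the linear coefficient \<open>2 * s w\<close>.\<close>
    have "m * s ?v \<le> b ?v ?v" by (rule min)
    then show "0 \<le> 2 * t * s w + t\<^sup>2 * (b w w - m * s w)"
      unfolding b s bs bwu su m_def[symmetric] by (simp add: algebra_simps)
  qed
  then have "w i = 0" if "i < n" for i
    using that by (simp add: s_def sum_nonneg_eq_0_iff)
  then have "(\<Sum>j<n. a i j * u j) = m * u i" if "i < n" for i
    using that by (simp add: w_def)
  moreover have "\<exists>i<n. u i \<noteq> 0"
  proof (rule ccontr)
    assume "\<not> (\<exists>i<n. u i \<noteq> 0)"
    then have "s u = 0" by (simp add: s_def)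
    with su show False by simp
  qed
  ultimately show thesis using that[of u m] min by (simp add: b_def s_def)
qed

text \<open>The minimum \<open>m\<close> of the form on the unit sphere is itself an eigenvalue, so
  the least eigenvalue is at most \<open>m\<close>. Compactness thus stands in for a spectral
  decomposition.\<close>

lemma least_eigenvalue_rayleigh:
  assumes A: "A \<in> carrier_mat n n" and "n > 0"
    and sym: "\<And>i j. i < n \<Longrightarrow> j < n \<Longrightarrow> A $$ (i, j) = A $$ (j, i)"
  shows "least_eigenvalue A * (\<Sum>i<n. (v i)\<^sup>2) \<le> (\<Sum>i<n. \<Sum>j<n. A $$ (i, j) * v i * v j)"
proof -
  obtain u m where u: "\<exists>i<n. u i \<noteq> 0"
    "\<And>i. i < n \<Longrightarrow> (\<Sum>j<n. A $$ (i, j) * u j) = m * u i"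
    and m: "\<And>v. m * (\<Sum>i<n. (v i)\<^sup>2) \<le> (\<Sum>i<n. \<Sum>j<n. A $$ (i, j) * v i * v j)"
    using symmetric_form_minimum_eigenvector[of n "\<lambda>i j. A $$ (i, j)"] \<open>n > 0\<close> sym by blast
  have "eigenvector A (vec n u) m"
    unfolding eigenvector_def
  proof (intro conjI)
    show "vec n u \<noteq> 0\<^sub>v (dim_row A)" using u(1) A by (metis carrier_matD(1) index_vec index_zero_vec(1))
    show "A *\<^sub>v vec n u = m \<cdot>\<^sub>v vec n u"
      using A u(2) by (intro eq_vecI) (auto simp: scalar_prod_def atLeast0LessThan)
  qed (use A in auto)
  then have "m \<in> spectrum A" by (auto simp: spectrum_def eigenvalue_def)
  then have "least_eigenvalue A \<le> m"
    unfolding least_eigenvalue_def using card_finite_spectrum(1)[OF A] by simp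
  then have "least_eigenvalue A * (\<Sum>i<n. (v i)\<^sup>2) \<le> m * (\<Sum>i<n. (v i)\<^sup>2)"
    by (intro mult_right_mono sum_nonneg) auto
  with m show ?thesis by (rule order_trans[rotated])
qed

section \<open>Second-order expansion of the logistic function\<close>

text \<open>Both signs come from \<open>1 + t \<le> exp t\<close>: at \<open>t = - h\<close>,
  multiplied by \<open>exp h\<close>, when \<open>h \<ge> 0\<close>, and at \<open>t = h\<close>
  otherwise.\<close>

lemma abs_exp_minus_one_le: "\<bar>exp h - 1\<bar> \<le> \<bar>h\<bar> * exp \<bar>h\<bar>" for h :: real
proof (cases "h \<ge> 0")
  case True
  have "1 - h \<le> exp (- h)" using exp_ge_add_one_self[of "- h"] by simp
  then have "(1 - h) * exp h \<le> exp (- h) * exp h" by (rule mult_right_mono) simp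
  then show ?thesis using True by (simp add: exp_minus algebra_simps)
next
  case False
  have "exp h \<ge> 1 + h" by (rule exp_ge_add_one_self)
  moreover have "(- h) * 1 \<le> (- h) * exp (- h)" using False by (intro mult_left_mono) auto
  moreover have "exp h < 1" using False by simp
  ultimately have "1 - exp h \<le> (- h) * exp (- h)" by linarith
  then show ?thesis using False by simp
qed

text \<open>With \<open>p = f t\<^sub>0\<close> for the logistic function \<open>f\<close>, the fraction is \<open>f (t\<^sub>0 + h)\<close>.\<close>

lemma logistic_taylor:
  fixes p h H :: real
  assumes p: "0 < p" "p < 1" and h: "\<bar>h\<bar> \<le> H"
  shows "\<bar>p * exp h / (1 - p + p * exp h) - p - p * (1 - p) * h\<bar> \<le> p * (1 - p) * (exp (2 * H) * h\<^sup>2)"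
proof -
  \<comment> \<open>\<open>Y\<close> is the second-order remainder of \<open>exp\<close> and
    \<open>X\<close> majorises it. The remainder to be bounded is exactly
    \<open>p * (1 - p) * (Y - p * X) / D\<close>.\<close>
  define D where "D = 1 - p + p * exp h"
  define X where "X = h * (exp h - 1)"
  define Y where "Y = exp h - 1 - h"
  \<comment> \<open>\<open>D\<close> is a convex combination of 1 and \<open>exp h\<close>, both at
    least \<open>exp (- H)\<close>.\<close>
  have D: "exp (- H) \<le> D"
  proof -
    have "exp (- H) \<le> exp h" using h by simp
    moreover have "exp (- H) \<le> 1" using h by simp
    ultimately have "(1 - p) * exp (- H) + p * exp (- H) \<le> (1 - p) * 1 + p * exp h"
      using p by (intro add_mono mult_left_mono) auto
    then show ?thesis by (simp add: D_def algebra_simps)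
  qed
  have Dpos: "D > 0" using D exp_gt_zero[of "- H"] by linarith
  have Y: "0 \<le> Y" "Y \<le> X"
  proof -
    show "0 \<le> Y" using exp_ge_add_one_self[of h] unfolding Y_def by linarith
    have "1 - h \<le> exp (- h)" using exp_ge_add_one_self[of "- h"] by simp
    then have "(1 - h) * exp h \<le> exp (- h) * exp h" by (rule mult_right_mono) simp
    then show "Y \<le> X" by (simp add: exp_minus X_def Y_def algebra_simps)
  qed
  have X: "X \<le> exp H * h\<^sup>2"
  proof -
    have "X \<le> \<bar>h\<bar> * \<bar>exp h - 1\<bar>" unfolding X_def abs_mult[symmetric] by (rule abs_ge_self)
    also have "\<dots> \<le> \<bar>h\<bar> * (\<bar>h\<bar> * exp \<bar>h\<bar>)"
      by (intro mult_left_mono abs_exp_minus_one_le) auto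
    also have "\<dots> = exp \<bar>h\<bar> * h\<^sup>2" by (simp add: power2_eq_square)
    also have "\<dots> \<le> exp H * h\<^sup>2" using h by (intro mult_right_mono) auto
    finally show ?thesis .
  qed
  \<comment> \<open>\<open>Y\<close> and \<open>p * X\<close> both lie between 0 and
    \<open>X\<close>, hence so does the absolute value of their difference.\<close>
  have "0 \<le> p * X" "p * X \<le> X" using Y p by (auto simp: mult_left_le_one_le)
  then have N: "\<bar>Y - p * X\<bar> \<le> X" using Y by linarith
  have "p * exp h / D - p - p * (1 - p) * h = p * (1 - p) * ((Y - p * X) / D)"
    using Dpos by (simp add: field_simps) (simp add: D_def X_def Y_def algebra_simps power2_eq_square)
  also have "\<bar>\<dots>\<bar> = p * (1 - p) * (\<bar>Y - p * X\<bar> / D)"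
    using p Dpos by (simp add: abs_mult)
  also have "\<dots> \<le> p * (1 - p) * (exp H * h\<^sup>2 / exp (- H))"
    using p D Dpos N X by (intro mult_left_mono frac_le) auto
  also have "exp H * h\<^sup>2 / exp (- H) = exp (2 * H) * h\<^sup>2"
    unfolding exp_minus mult_2 exp_add by (simp add: divide_inverse mult_ac)
  finally show ?thesis by (simp add: D_def)
qed


section \<open>Invertibility and rows of the signless Laplacian\<close>

text \<open>On a kernel vector the form vanishes, so positivity forces that vector to be 0 and the
  determinant is nonzero. This gives \<open>the (mat_inverse A)\<close> its intended
  meaning.\<close>

lemma positive_least_eigenvalue_mat_inverse:
  assumes A: "A \<in> carrier_mat n n" and "n > 0"
    and sym: "\<And>i j. i < n \<Longrightarrow> j < n \<Longrightarrow> A $$ (i, j) = A $$ (j, i)"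
    and pos: "least_eigenvalue A > 0"
  obtains B where "mat_inverse A = Some B" "A * B = 1\<^sub>m n" "B \<in> carrier_mat n n"
proof -
  have "det A \<noteq> 0"
  proof
    assume "det A = 0"
    then obtain v where v: "v \<in> carrier_vec n" "v \<noteq> 0\<^sub>v n" "A *\<^sub>v v = 0\<^sub>v n"
      using det_0_iff_vec_prod_zero_field[OF A] by blast
    have "(\<Sum>j<n. A $$ (i, j) * v $ j) = 0" if "i < n" for i
    proof -
      have "(\<Sum>j<n. A $$ (i, j) * v $ j) = (A *\<^sub>v v) $ i"
        using A v(1) that by (auto simp: scalar_prod_def atLeast0LessThan)
      then show ?thesis using v(3) that by simp
    qed
    then have "(\<Sum>i<n. \<Sum>j<n. A $$ (i, j) * v $ i * v $ j) = 0"
      by (simp add: sum_distrib_left[symmetric] mult.commute mult.left_commute)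
    then have "least_eigenvalue A * (\<Sum>i<n. (v $ i)\<^sup>2) \<le> 0"
      using least_eigenvalue_rayleigh[OF A \<open>n > 0\<close> sym, of "($) v"] by simp
    with pos have "(\<Sum>i<n. (v $ i)\<^sup>2) \<le> 0" by (simp add: mult_le_0_iff)
    then have "(\<Sum>i<n. (v $ i)\<^sup>2) = 0" by (simp add: antisym sum_nonneg)
    then have "v = 0\<^sub>v n" using v(1) by (intro eq_vecI) (auto simp: sum_nonneg_eq_0_iff)
    with v(2) show False ..
  qed
  then have "A \<in> Units (ring_mat TYPE(real) n ())" by (rule det_non_zero_imp_unit[OF A])
  with mat_inverse(1)[OF A, of "()"] obtain B where B: "mat_inverse A = Some B"
    by (cases "mat_inverse A") auto
  with mat_inverse(2)[OF A B] show thesis using that by blast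
qed

lemma signless_laplacian_carrier: "signless_laplacian n E \<in> carrier_mat n n"
  by (simp add: signless_laplacian_def)

lemma signless_laplacian_sym:
  "i < n \<Longrightarrow> j < n \<Longrightarrow> signless_laplacian n E $$ (i, j) = signless_laplacian n E $$ (j, i)"
  by (simp add: signless_laplacian_def insert_commute)

lemma simple_graph_irrefl: "simple_graph n E \<Longrightarrow> {j} \<notin> E"
  by (auto simp: simple_graph_def doubleton_eq_iff)

text \<open>The diagonal splits off cleanly because a simple graph has no edge
  \<open>{j, j}\<close>, so \<open>j\<close> does not occur in the neighbour sum.\<close>

lemma signless_laplacian_row_sum:
  assumes "simple_graph n E" "j < n"
  shows "(\<Sum>k<n. signless_laplacian n E $$ (j, k) * y k) =
    real (deg n E j) * y j + (\<Sum>k\<in>{k. k < n \<and> {j, k} \<in> E}. y k)"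
proof -
  have "(\<Sum>k<n. signless_laplacian n E $$ (j, k) * y k) =
    (\<Sum>k<n. (if j = k then real (deg n E j) * y k else 0) + (if {j, k} \<in> E then y k else 0))"
    using assms simple_graph_irrefl[OF assms(1)]
    by (intro sum.cong) (auto simp: signless_laplacian_def)
  also have "\<dots> = real (deg n E j) * y j + (\<Sum>k<n. if {j, k} \<in> E then y k else 0)"
    using assms(2) by (simp add: sum.distrib)
  also have "(\<Sum>k<n. if {j, k} \<in> E then y k else 0) = (\<Sum>k\<in>{k. k < n \<and> {j, k} \<in> E}. y k)"
    by (subst sum.inter_filter[symmetric]) auto
  finally show ?thesis .
qed

section \<open>Comparison of norms\<close>

lemma norm_inf_upper: "j < n \<Longrightarrow> \<bar>x j\<bar> \<le> norm_inf n x"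
  unfolding norm_inf_def by (intro Max_ge) auto

lemma norm_inf_le:
  assumes "n > 0" "\<And>j. j < n \<Longrightarrow> \<bar>x j\<bar> \<le> c"
  shows "norm_inf n x \<le> c"
  unfolding norm_inf_def using assms by (subst Max_le_iff) auto

lemma norm_inf_nonneg: "n > 0 \<Longrightarrow> 0 \<le> norm_inf n x"
  using norm_inf_upper[of 0 n x] by linarith

lemma norm_2_nonneg: "0 \<le> norm_2 n x"
  by (simp add: norm_2_def)

lemma norm_2_squared: "(norm_2 n x)\<^sup>2 = (\<Sum>i<n. (x i)\<^sup>2)"
  by (simp add: norm_2_def L2_set_def sum_nonneg)

lemma norm_2_le_norm_inf:
  assumes "n > 0"
  shows "norm_2 n x \<le> sqrt n * norm_inf n x"
proof (rule power2_le_imp_le)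
  have "(\<Sum>i<n. (x i)\<^sup>2) \<le> (\<Sum>i<n. (norm_inf n x)\<^sup>2)"
    using norm_inf_upper[of _ n x] by (intro sum_mono) (metis abs_ge_zero lessThan_iff power2_abs power_mono)
  then show "(norm_2 n x)\<^sup>2 \<le> (sqrt n * norm_inf n x)\<^sup>2"
    by (simp add: norm_2_squared power_mult_distrib)
qed (simp add: assms norm_inf_nonneg)

text \<open>Cauchy-Schwarz against the constant vector 1.\<close>

lemma sum_abs_le_norm_2: "(\<Sum>i<n. \<bar>x i\<bar>) \<le> sqrt n * norm_2 n x"
  using L2_set_mult_ineq[of x "\<lambda>_. 1" "{..<n}"]
  by (simp add: norm_2_def L2_set_def mult.commute)

section \<open>Norm bounds for solutions of the signless Laplacian system\<close>

text \<open>The system \<open>Qy = x\<close> is written row by row with neighbour sums, so that the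
  estimates do not mention an inverse. Later \<open>x\<close> is \<open>d - \<lambda>g\<close> and
  \<open>y / \<Lambda>\<close> is \<open>\<gamma>\<close>.\<close>

context
  fixes n :: nat and E :: "nat set set" and \<tau> :: real and x y :: "nat \<Rightarrow> real"
  assumes n: "n > 0" and E: "simple_graph n E" and \<tau>: "\<tau> > 0"
    and least: "\<tau> * real n \<le> least_eigenvalue (signless_laplacian n E)"
    and y: "\<And>j. j < n \<Longrightarrow>
      real (deg n E j) * y j + (\<Sum>k\<in>{k. k < n \<and> {j, k} \<in> E}. y k) = x j"
begin

lemma signless_laplacian_form_ge:
  "\<tau> * n * (\<Sum>i<n. (v i)\<^sup>2) \<le> (\<Sum>i<n. \<Sum>j<n. signless_laplacian n E $$ (i, j) * v i * v j)"
proof -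
  have "\<tau> * n * (\<Sum>i<n. (v i)\<^sup>2) \<le> least_eigenvalue (signless_laplacian n E) * (\<Sum>i<n. (v i)\<^sup>2)"
    using least by (intro mult_right_mono sum_nonneg) auto
  also note least_eigenvalue_rayleigh[OF signless_laplacian_carrier n signless_laplacian_sym]
  finally show ?thesis .
qed

text \<open>The form at \<open>y\<close> is at least \<open>\<tau> * n\<close> times the squared
  norm of \<open>y\<close>; it equals the inner product of \<open>y\<close> and \<open>x\<close>,
  which Cauchy-Schwarz bounds. One factor \<open>norm_2 n y\<close> then cancels.\<close>

lemma signless_solution_norm_2: "\<tau> * n * norm_2 n y \<le> norm_2 n x"
proof -
  have "\<tau> * n * (norm_2 n y)\<^sup>2 \<le> (\<Sum>i<n. \<Sum>j<n. signless_laplacian n E $$ (i, j) * y i * y j)"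
    unfolding norm_2_squared by (rule signless_laplacian_form_ge)
  also have "\<dots> = (\<Sum>i<n. y i * (\<Sum>j<n. signless_laplacian n E $$ (i, j) * y j))"
    by (simp add: sum_distrib_left mult_ac)
  also have "\<dots> = (\<Sum>i<n. y i * x i)"
    using y by (simp add: signless_laplacian_row_sum[OF E])
  also have "\<dots> \<le> (\<Sum>i<n. \<bar>y i\<bar> * \<bar>x i\<bar>)"
    by (intro sum_mono) (metis abs_ge_self abs_mult)
  also have "\<dots> \<le> norm_2 n y * norm_2 n x"
    unfolding norm_2_def by (rule L2_set_mult_ineq)
  finally have "norm_2 n y * (\<tau> * n * norm_2 n y) \<le> norm_2 n y * norm_2 n x"
    by (simp add: power2_eq_square mult_ac)
  moreover have "norm_2 n y = 0 \<or> norm_2 n y > 0" using norm_2_nonneg[of n y] by linarith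
  ultimately show ?thesis using norm_2_nonneg[of n x] by auto
qed

text \<open>The neighbour sum in row \<open>j\<close> is at most \<open>sqrt n * norm_2 n y\<close>,
  hence at most \<open>norm_inf n x / \<tau>\<close>. This is the source of
  \<open>1 + 1 / \<tau>\<close>; the outer division by \<open>\<tau>\<close> comes from the degree
  bound.\<close>

lemma signless_solution_abs_le:
  assumes j: "j < n"
  shows "\<bar>y j\<bar> \<le> (1 + 1 / \<tau>) / \<tau> * norm_inf n x / n"
proof -
  let ?X = "norm_inf n x" and ?N = "{k. k < n \<and> {j, k} \<in> E}"
  have deg: "\<tau> * n \<le> deg n E j"
  proof -
    have "\<tau> * n * (\<Sum>i<n. (if i = j then 1 else 0)\<^sup>2) \<le>
      (\<Sum>i<n. \<Sum>k<n. signless_laplacian n E $$ (i, k) * (if i = j then 1 else 0) * (if k = j then 1 else 0))"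
      by (rule signless_laplacian_form_ge)
    then show ?thesis using j
      by (simp add: if_distrib[of "\<lambda>x. x\<^sup>2"] if_distrib[of "\<lambda>x. _ * x"] signless_laplacian_def cong: if_cong)
  qed
  have "\<bar>\<Sum>k\<in>?N. y k\<bar> \<le> (\<Sum>k\<in>?N. \<bar>y k\<bar>)" by (rule sum_abs)
  also have "\<dots> \<le> (\<Sum>k<n. \<bar>y k\<bar>)" by (intro sum_mono2) auto
  also have "\<dots> \<le> sqrt n * norm_2 n y" by (rule sum_abs_le_norm_2)
  also have "\<dots> \<le> sqrt n * (norm_2 n x / (\<tau> * n))"
    using signless_solution_norm_2 n \<tau> by (intro mult_left_mono) (auto simp: field_simps)
  also have "\<dots> \<le> sqrt n * ((sqrt n * ?X) / (\<tau> * n))"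
    using norm_2_le_norm_inf[OF n] n \<tau> by (intro mult_left_mono divide_right_mono) auto
  also have "\<dots> = ?X / \<tau>" using n \<tau> by (simp add: field_simps)
  finally have sum: "\<bar>\<Sum>k\<in>?N. y k\<bar> \<le> ?X / \<tau>" .
  have "\<tau> * n * \<bar>y j\<bar> \<le> deg n E j * \<bar>y j\<bar>" using deg by (rule mult_right_mono) simp
  also have "\<dots> = \<bar>x j - (\<Sum>k\<in>?N. y k)\<bar>"
    by (simp add: abs_mult flip: y[OF j])
  also have "\<dots> \<le> ?X + ?X / \<tau>"
    using sum norm_inf_upper[OF j, of x] by linarith
  finally have "\<tau> * n * \<bar>y j\<bar> \<le> ?X + ?X / \<tau>" .
  then show ?thesis using n \<tau> by (simp add: field_simps)
qed

end

section \<open>Discrepancy of the approximate solution\<close>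

text \<open>Passes from the matrix definition of \<open>\<gamma>\<close> to the row equations; the
  witness is the inverse of \<open>Q\<close> applied to the deviation, before the scaling by
  \<open>1 / \<Lambda>\<close>.\<close>

lemma gamma_vec_solution:
  assumes n: "n > 0" and E: "simple_graph n E"
    and least: "0 < least_eigenvalue (signless_laplacian n E)"
  shows "\<exists>y. \<forall>j<n.
    real (deg n E j) * y j + (\<Sum>k\<in>{k. k < n \<and> {j, k} \<in> E}. y k) = deviation n E d j \<and>
    gamma_vec n E d $ j = y j / Lam n E d"
proof -
  let ?Q = "signless_laplacian n E" and ?x = "vec n (deviation n E d)"
  obtain B where B: "mat_inverse ?Q = Some B" "?Q * B = 1\<^sub>m n" "B \<in> carrier_mat n n"
    using positive_least_eigenvalue_mat_inverse[OF signless_laplacian_carrier n signless_laplacian_sym least] .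
  define y where "y = B *\<^sub>v ?x"
  have yc: "y \<in> carrier_vec n" using B(3) by (simp add: y_def)
  have "?Q *\<^sub>v y = (?Q * B) *\<^sub>v ?x"
    unfolding y_def using B(3)
    by (intro assoc_mult_mat_vec[OF signless_laplacian_carrier, symmetric]) auto
  then have Qy: "?Q *\<^sub>v y = ?x" using B(2) by simp
  have "real (deg n E j) * y $ j + (\<Sum>k\<in>{k. k < n \<and> {j, k} \<in> E}. y $ k) = deviation n E d j"
    if "j < n" for j
  proof -
    have "deviation n E d j = (?Q *\<^sub>v y) $ j" using Qy that by simp
    also have "\<dots> = (\<Sum>k<n. ?Q $$ (j, k) * y $ k)"
      using that yc signless_laplacian_carrier[of n E] by (auto simp: scalar_prod_def atLeast0LessThan)
    finally show ?thesis using signless_laplacian_row_sum[OF E that] by simp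
  qed
  moreover have "gamma_vec n E d $ j = y $ j / Lam n E d" if "j < n" for j
    using that yc B(1) by (simp add: gamma_vec_def y_def[symmetric])
  ultimately show ?thesis by blast
qed


text \<open>The two halves of the logarithm add up, so
  \<open>exp (\<beta>\<^sub>j + \<beta>\<^sub>k)\<close> is the odds
  \<open>\<lambda> / (1 - \<lambda>)\<close> times
  \<open>exp (\<gamma>\<^sub>j + \<gamma>\<^sub>k)\<close>. Clearing \<open>1 - \<lambda>\<close>
  gives the shape expected by \<open>logistic_taylor\<close>.\<close>

lemma edge_prob_beta:
  assumes p: "0 < density n E d" "density n E d < 1"
  shows "edge_prob (beta n E d) j k =
    density n E d * exp (gamma_vec n E d $ j + gamma_vec n E d $ k) /
      (1 - density n E d + density n E d * exp (gamma_vec n E d $ j + gamma_vec n E d $ k))"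
proof -
  let ?p = "density n E d" and ?h = "gamma_vec n E d $ j + gamma_vec n E d $ k"
  have "beta n E d j + beta n E d k = ln (?p / (1 - ?p)) + ?h"
    by (simp add: beta_def)
  then have e: "exp (beta n E d j + beta n E d k) = ?p / (1 - ?p) * exp ?h"
    using p by (simp only: exp_add[of "ln _"] exp_ln divide_pos_pos diff_gt_0_iff_gt)
  have "1 + ?p / (1 - ?p) * exp ?h = (1 - ?p + ?p * exp ?h) / (1 - ?p)"
    using p by (simp add: add_divide_distrib)
  then show ?thesis unfolding edge_prob_def e using p by simp
qed

text \<open>By \<open>sol\<close>, that is \<open>\<Lambda>Q\<gamma> = d - \<lambda>g\<close> in row
  \<open>j\<close>, the terms of order zero and one sum to \<open>d j\<close> exactly, so only
  Taylor remainders survive. Their arguments are at most \<open>2 * H\<close>, whence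
  \<open>exp (4 * H)\<close>.\<close>

lemma discrepancy_beta_abs_le:
  assumes j: "j < n"
    and p: "0 < density n E d" "density n E d < 1"
    and bound: "\<And>k. k < n \<Longrightarrow> \<bar>gamma_vec n E d $ k\<bar> \<le> H"
    and sol: "Lam n E d * (real (deg n E j) * gamma_vec n E d $ j +
      (\<Sum>k\<in>{k. k < n \<and> {j, k} \<in> E}. gamma_vec n E d $ k)) = deviation n E d j"
  shows "\<bar>discrepancy n E d (beta n E d) j\<bar> \<le> Lam n E d * exp (4 * H) *
    (\<Sum>k\<in>{k. k < n \<and> {j, k} \<in> E}. (gamma_vec n E d $ j + gamma_vec n E d $ k)\<^sup>2)"
proof -
  let ?N = "{k. k < n \<and> {j, k} \<in> E}" and ?p = "density n E d" and ?L = "Lam n E d"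
    and ?b = "beta n E d"
  define g where "g = (\<lambda>k. gamma_vec n E d $ k)"
  have "(\<Sum>k\<in>?N. ?p + ?L * (g j + g k)) =
      ?p * deg n E j + ?L * (deg n E j * g j + (\<Sum>k\<in>?N. g k))"
    by (simp add: sum.distrib flip: sum_distrib_left) (simp add: deg_def)
  also have "\<dots> = d j" using sol by (simp add: g_def deviation_def)
  finally have "discrepancy n E d ?b j =
      (\<Sum>k\<in>?N. edge_prob ?b j k) - (\<Sum>k\<in>?N. ?p + ?L * (g j + g k))"
    unfolding discrepancy_def by simp
  also have "\<dots> = (\<Sum>k\<in>?N. edge_prob ?b j k - ?p - ?L * (g j + g k))"
    unfolding sum_subtractf[symmetric] by (simp add: algebra_simps)
  finally have "\<bar>discrepancy n E d ?b j\<bar> =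
      \<bar>\<Sum>k\<in>?N. edge_prob ?b j k - ?p - ?L * (g j + g k)\<bar>" by (rule arg_cong)
  also have "\<dots> \<le> (\<Sum>k\<in>?N. \<bar>edge_prob ?b j k - ?p - ?L * (g j + g k)\<bar>)"
    by (rule sum_abs)
  also have "\<dots> \<le> (\<Sum>k\<in>?N. ?L * (exp (2 * (2 * H)) * (g j + g k)\<^sup>2))"
  proof (rule sum_mono)
    fix k assume "k \<in> ?N"
    then have "\<bar>g j + g k\<bar> \<le> 2 * H" using bound[OF j] bound[of k] by (simp add: g_def)
    from logistic_taylor[OF p this]
    show "\<bar>edge_prob ?b j k - ?p - ?L * (g j + g k)\<bar> \<le> ?L * (exp (2 * (2 * H)) * (g j + g k)\<^sup>2)"
      by (simp add: edge_prob_beta[OF p] g_def Lam_def)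
  qed
  finally show ?thesis by (simp add: g_def sum_distrib_left mult.assoc)
qed

text \<open>\<open>H\<close> bounds all \<open>\<gamma>\<^sub>j\<close> and enters only the spread
  and the exponential factor. The quadratic factors keep the actual norms of the deviation: the
  maximum norm for the first discrepancy bound, the 2-norm for the second.\<close>

lemma beta_bounds:
  fixes \<tau> H :: real
  defines "c \<equiv> (1 + 1 / \<tau>) / \<tau>"
  assumes n: "n > 0" and E: "simple_graph n E" and \<tau>: "\<tau> > 0"
    and least: "\<tau> * real n \<le> least_eigenvalue (signless_laplacian n E)"
    and L: "Lam n E d > 0"
    and H: "c * norm_inf n (deviation n E d) / (Lam n E d * n) \<le> H"
  shows "spread_bounded (2 * H) n (beta n E d)"
    and "norm_inf n (discrepancy n E d (beta n E d))
      \<le> 4 * exp (4 * H) * c\<^sup>2 * (1 / (Lam n E d * n)) * (norm_inf n (deviation n E d))\<^sup>2"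
    and "norm_1 n (discrepancy n E d (beta n E d))
      \<le> 4 * exp (4 * H) / \<tau>\<^sup>2 * (1 / (Lam n E d * n)) * (norm_2 n (deviation n E d))\<^sup>2"
proof -
  let ?L = "Lam n E d" and ?x = "deviation n E d" and ?\<delta> = "discrepancy n E d (beta n E d)"
  let ?N = "\<lambda>j. {k. k < n \<and> {j, k} \<in> E}" and ?D = "exp (4 * H)"
  define g where "g = (\<lambda>j. gamma_vec n E d $ j)"
  define G where "G = c * norm_inf n ?x / (?L * n)"
  \<comment> \<open>If both factors of \<open>\<Lambda>\<close> were negative, the density would be
    below 0 and above 1.\<close>
  have p: "0 < density n E d" "density n E d < 1"
    using L by (auto simp: Lam_def zero_less_mult_iff)
  have "0 < least_eigenvalue (signless_laplacian n E)"
    using least n \<tau> by (smt (verit) mult_pos_pos of_nat_0_less_iff)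
  then obtain y where y: "\<forall>j<n. real (deg n E j) * y j + (\<Sum>k\<in>?N j. y k) = ?x j \<and>
      gamma_vec n E d $ j = y j / ?L"
    using gamma_vec_solution[OF n E, of d] by blast
  have y1: "real (deg n E j) * y j + (\<Sum>k\<in>?N j. y k) = ?x j" if "j < n" for j
    using y that by blast
  have y2: "g j = y j / ?L" if "j < n" for j using y that by (simp add: g_def)
  have sol: "?L * (real (deg n E j) * g j + (\<Sum>k\<in>?N j. g k)) = ?x j" if "j < n" for j
  proof -
    have "?L * (\<Sum>k\<in>?N j. g k) = (\<Sum>k\<in>?N j. y k)"
      unfolding sum_distrib_left using L y2 by (intro sum.cong) auto
    then show ?thesis using y1[OF that] y2[OF that] L by (simp add: algebra_simps)
  qed
  have gG: "\<bar>g j\<bar> \<le> G" if "j < n" for j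
  proof -
    have "\<bar>y j\<bar> \<le> c * norm_inf n ?x / n"
      unfolding c_def by (rule signless_solution_abs_le[OF n E \<tau> least y1 that])
    then have "\<bar>y j\<bar> / ?L \<le> c * norm_inf n ?x / n / ?L"
      using L by (intro divide_right_mono) auto
    then show ?thesis using y2[OF that] L by (simp add: G_def mult.commute)
  qed
  then have gH: "\<bar>g j\<bar> \<le> H" if "j < n" for j
    using H that unfolding G_def by (meson order_trans)
  have \<delta>: "\<bar>?\<delta> j\<bar> \<le> ?L * ?D * (\<Sum>k\<in>?N j. (g j + g k)\<^sup>2)" if "j < n" for j
    using discrepancy_beta_abs_le[OF that p] gH sol[OF that] by (simp add: g_def)

  \<comment> \<open>The common logarithmic shift cancels in differences of
    \<open>beta\<close>.\<close>
  show "spread_bounded (2 * H) n (beta n E d)"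
    unfolding spread_bounded_def
  proof (intro allI impI)
    fix j k assume "j < n" "k < n"
    then show "\<bar>beta n E d j - beta n E d k\<bar> \<le> 2 * H"
      using gH[of j] gH[of k] by (simp add: beta_def g_def)
  qed

  show "norm_inf n ?\<delta> \<le> 4 * ?D * c\<^sup>2 * (1 / (?L * n)) * (norm_inf n ?x)\<^sup>2"
  proof (rule norm_inf_le[OF n])
    fix j assume j: "j < n"
    have "(\<Sum>k\<in>?N j. (g j + g k)\<^sup>2) \<le> (\<Sum>k\<in>?N j. (2 * G)\<^sup>2)"
    proof (rule sum_mono)
      fix k assume "k \<in> ?N j"
      then have "\<bar>g j + g k\<bar> \<le> \<bar>2 * G\<bar>" using gG[OF j] gG[of k] by simp
      then show "(g j + g k)\<^sup>2 \<le> (2 * G)\<^sup>2" by (simp only: abs_le_square_iff)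
    qed
    also have "\<dots> \<le> (\<Sum>k<n. (2 * G)\<^sup>2)" by (intro sum_mono2) auto
    finally have "(\<Sum>k\<in>?N j. (g j + g k)\<^sup>2) \<le> n * (2 * G)\<^sup>2" by simp
    then have "?L * ?D * (\<Sum>k\<in>?N j. (g j + g k)\<^sup>2) \<le> ?L * ?D * (n * (2 * G)\<^sup>2)"
      using L by (intro mult_left_mono) auto
    also have "\<dots> = 4 * ?D * c\<^sup>2 * (1 / (?L * n)) * (norm_inf n ?x)\<^sup>2"
      using L n by (simp add: G_def field_simps power2_eq_square)
    finally show "\<bar>?\<delta> j\<bar> \<le> 4 * ?D * c\<^sup>2 * (1 / (?L * n)) * (norm_inf n ?x)\<^sup>2"
      using \<delta>[OF j] by linarith
  qed

  \<comment> \<open>Separating the two squares keeps the 2-norm available: summed over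
    \<open>j\<close>, each part contributes \<open>2 * n\<close> times the squared norm of
    \<open>g\<close>.\<close>
  have row: "(\<Sum>k\<in>?N j. (g j + g k)\<^sup>2) \<le> 2 * n * (g j)\<^sup>2 + 2 * (\<Sum>k<n. (g k)\<^sup>2)" for j
  proof -
    have "(\<Sum>k\<in>?N j. (g j + g k)\<^sup>2) \<le> (\<Sum>k<n. (g j + g k)\<^sup>2)"
      by (intro sum_mono2) auto
    also have "\<dots> \<le> (\<Sum>k<n. 2 * (g j)\<^sup>2 + 2 * (g k)\<^sup>2)"
    proof (rule sum_mono)
      fix k
      show "(g j + g k)\<^sup>2 \<le> 2 * (g j)\<^sup>2 + 2 * (g k)\<^sup>2"
        using zero_le_power2[of "g j - g k"] by (simp add: power2_sum power2_diff)
    qed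
    finally show ?thesis by (simp add: sum.distrib sum_distrib_left)
  qed
  have "norm_1 n ?\<delta> \<le> (\<Sum>j<n. ?L * ?D * (2 * n * (g j)\<^sup>2 + 2 * (\<Sum>k<n. (g k)\<^sup>2)))"
    unfolding norm_1_def
  proof (rule sum_mono)
    fix j assume "j \<in> {..<n}"
    then have "\<bar>?\<delta> j\<bar> \<le> ?L * ?D * (\<Sum>k\<in>?N j. (g j + g k)\<^sup>2)" using \<delta> by simp
    also have "\<dots> \<le> ?L * ?D * (2 * n * (g j)\<^sup>2 + 2 * (\<Sum>k<n. (g k)\<^sup>2))"
      using L by (intro mult_left_mono row) auto
    finally show "\<bar>?\<delta> j\<bar> \<le> ?L * ?D * (2 * n * (g j)\<^sup>2 + 2 * (\<Sum>k<n. (g k)\<^sup>2))" .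
  qed
  also have "\<dots> = ?L * ?D * (4 * n * (\<Sum>k<n. (g k)\<^sup>2))"
    by (simp add: sum.distrib flip: sum_distrib_left)
  also have "(\<Sum>k<n. (g k)\<^sup>2) = (norm_2 n y)\<^sup>2 / ?L\<^sup>2"
    using y2 by (simp add: norm_2_squared power_divide sum_divide_distrib)
  \<comment> \<open>Rearranged to expose \<open>\<tau> * n * norm_2 n y\<close>, the quantity
    controlled by \<open>signless_solution_norm_2\<close>.\<close>
  also have "?L * ?D * (4 * n * ((norm_2 n y)\<^sup>2 / ?L\<^sup>2)) =
      4 * ?D / \<tau>\<^sup>2 * (1 / (?L * n)) * (\<tau> * n * norm_2 n y)\<^sup>2"
    using L n \<tau> by (simp add: field_simps power2_eq_square)
  also have "\<dots> \<le> 4 * ?D / \<tau>\<^sup>2 * (1 / (?L * n)) * (norm_2 n ?x)\<^sup>2"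
    using signless_solution_norm_2[OF n E \<tau> least y1] L n \<tau> norm_2_nonneg[of n y]
    by (intro mult_left_mono power_mono) auto
  finally show "norm_1 n ?\<delta> \<le> 4 * ?D / \<tau>\<^sup>2 * (1 / (?L * n)) * (norm_2 n ?x)\<^sup>2" .
qed

section \<open>Orders of magnitude in \<open>n\<close> and \<open>\<Lambda>\<close>\<close>

text \<open>The quotient has order \<open>L powr (-1/4) * n powr (-1/4 - \<sigma>/4)\<close>, and
  the lower bound on \<open>L\<close> turns this into \<open>n powr (- \<sigma>/2)\<close>, at most
  1. Hence \<open>\<gamma>\<close> is bounded by a constant.\<close>

lemma gamma_scale_le:
  fixes B \<sigma> L c K X :: real
  assumes "n > 0" "B > 0" "\<sigma> > 0" "c \<ge> 0" "K \<ge> 0"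
    and L: "L \<ge> B * real n powr (\<sigma> - 1)"
    and X: "X \<le> K * (L powr (3/4) * real n powr (3/4 - \<sigma>/4))"
  shows "c * X / (L * n) \<le> c * K * B powr (-1/4)"
proof -
  have n1: "real n \<ge> 1" using \<open>n > 0\<close> by simp
  have Bn: "B * real n powr (\<sigma> - 1) > 0" using \<open>B > 0\<close> \<open>n > 0\<close> by simp
  then have Lpos: "L > 0" using L by linarith
  have "c * X / (L * n) \<le> c * (K * (L powr (3/4) * real n powr (3/4 - \<sigma>/4))) / (L * n)"
    using X Lpos \<open>c \<ge> 0\<close> by (intro divide_right_mono mult_left_mono) auto
  also have "\<dots> = c * K * ((L powr (3/4) / L powr 1) * (real n powr (3/4 - \<sigma>/4) / real n powr 1))"
    using Lpos n1 by simp
  also have "\<dots> = c * K * (L powr (-1/4) * real n powr (-1/4 - \<sigma>/4))"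
    by (simp only: powr_diff[symmetric]) simp
  also have "\<dots> \<le> c * K * ((B * real n powr (\<sigma> - 1)) powr (-1/4) * real n powr (-1/4 - \<sigma>/4))"
    using L Bn assms by (intro mult_left_mono mult_right_mono powr_mono2') auto
  also have "\<dots> = c * K * (B powr (-1/4) * (real n powr ((\<sigma> - 1) * (-1/4)) * real n powr (-1/4 - \<sigma>/4)))"
    using \<open>B > 0\<close> by (simp add: powr_mult powr_powr)
  also have "\<dots> = c * K * (B powr (-1/4) * real n powr (- \<sigma> / 2))"
    by (simp add: field_simps flip: powr_add)
  also have "\<dots> \<le> c * K * (B powr (-1/4) * real n powr 0)"
    using n1 assms by (intro mult_left_mono powr_mono) auto
  finally show ?thesis using n1 by simp
qed

text \<open>Turns the quadratic bounds into assumption (e): \<open>a = 3/4\<close>,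
  \<open>b = 3/4 - \<sigma>/4\<close> yields the exponents \<open>1/2\<close> and
  \<open>1/2 - \<sigma>/2\<close>, while \<open>a = 1/2\<close>, \<open>b = 1 + \<epsilon>/2\<close>
  yields 0 and \<open>1 + \<epsilon>\<close>.\<close>

lemma square_bound_scale:
  fixes L M K X m a b :: real
  assumes "L > 0" "m > 0" "M \<ge> 0" "0 \<le> X" and X: "X \<le> K * (L powr a * m powr b)"
  shows "M * (1 / (L * m)) * X\<^sup>2 \<le> M * K\<^sup>2 * (L powr (2 * a - 1) * m powr (2 * b - 1))"
proof -
  have "M * (1 / (L * m)) * X\<^sup>2 \<le> M * (1 / (L * m)) * (K * (L powr a * m powr b))\<^sup>2"
    using assms by (intro mult_left_mono power_mono) auto
  also have "\<dots> = M * K\<^sup>2 * (L powr (2 * a) / L powr 1 * (m powr (2 * b) / m powr 1))"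
    using assms by (simp add: power_mult_distrib powr_power mult.commute)
  also have "\<dots> = M * K\<^sup>2 * (L powr (2 * a - 1) * m powr (2 * b - 1))"
    by (simp only: powr_diff)
  finally show ?thesis .
qed

theorem theorem1p3:
  fixes \<sigma> B \<tau> :: real
  assumes "\<sigma> > 0" and "B > 0" and "\<tau> > 0"
  shows "\<exists>\<epsilon>0>0. \<forall>\<epsilon>::real. 0 < \<epsilon> \<and> \<epsilon> < \<epsilon>0 \<longrightarrow>
    (\<forall>K1>0. \<forall>K2>0. \<exists>C>0. \<exists>L1>0. \<exists>L2>0. \<exists>M1>0. \<exists>M2>0.
      \<forall>\<^sub>F n in sequentially. \<forall>E d.
        simple_graph n E \<and> pos_even_seq n d \<and>
        degrees_bounded n E d \<and> dense_enough \<sigma> B n E d \<and> expanding \<tau> n E d \<and>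
        norm_inf n (deviation n E d)
          \<le> K1 * (Lam n E d powr (3/4) * real n powr (3/4 - \<sigma>/4)) \<and>
        norm_2 n (deviation n E d)
          \<le> K2 * (Lam n E d powr (1/2) * real n powr (1 + \<epsilon>/2))
        \<longrightarrow>
        spread_bounded C n (beta n E d) \<and>
        discrepancy_small \<sigma> \<epsilon> L1 L2 n E d (beta n E d) \<and>
        norm_inf n (discrepancy n E d (beta n E d))
          \<le> M1 * (1 / (Lam n E d * real n)) * (norm_inf n (deviation n E d))^2 \<and>
        norm_1 n (discrepancy n E d (beta n E d))
          \<le> M2 * (1 / (Lam n E d * real n)) * (norm_2 n (deviation n E d))^2)"
proof (rule exI[of _ 1], rule conjI, simp, intro allI impI)
  fix \<epsilon> K1 K2 :: real
  assume K: "K1 > 0" "K2 > 0"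
  \<comment> \<open>\<open>c\<close> is the constant of the maximum bound on \<open>y\<close> and
    \<open>H\<close> the resulting bound on \<open>\<gamma>\<close>; \<open>M1\<close> and
    \<open>M2\<close> are the factors in \<open>beta_bounds\<close>. None of them depends on
    \<open>\<epsilon>\<close>, so the threshold 1 for \<open>\<epsilon>\<close> is
    arbitrary.\<close>
  define c where "c = (1 + 1 / \<tau>) / \<tau>"
  define H where "H = c * K1 * B powr (-1/4)"
  define M1 where "M1 = 4 * exp (4 * H) * c\<^sup>2"
  define M2 where "M2 = 4 * exp (4 * H) / \<tau>\<^sup>2"
  have c: "c > 0" using \<open>\<tau> > 0\<close> by (simp add: c_def add_pos_pos)
  have pos: "2 * H > 0" "M1 > 0" "M2 > 0" "M1 * K1\<^sup>2 > 0" "M2 * K2\<^sup>2 > 0"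
    using c K \<open>B > 0\<close> \<open>\<tau> > 0\<close> by (auto simp: H_def M1_def M2_def)
  have main: "spread_bounded (2 * H) n (beta n E d) \<and>
      discrepancy_small \<sigma> \<epsilon> (M1 * K1\<^sup>2) (M2 * K2\<^sup>2) n E d (beta n E d) \<and>
      norm_inf n (discrepancy n E d (beta n E d))
        \<le> M1 * (1 / (Lam n E d * real n)) * (norm_inf n (deviation n E d))^2 \<and>
      norm_1 n (discrepancy n E d (beta n E d))
        \<le> M2 * (1 / (Lam n E d * real n)) * (norm_2 n (deviation n E d))^2"
    if n: "n > 0" and E: "simple_graph n E" and "dense_enough \<sigma> B n E d"
      and "expanding \<tau> n E d"
      and X: "norm_inf n (deviation n E d)
        \<le> K1 * (Lam n E d powr (3/4) * real n powr (3/4 - \<sigma>/4))"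
      and X2: "norm_2 n (deviation n E d)
        \<le> K2 * (Lam n E d powr (1/2) * real n powr (1 + \<epsilon>/2))" for n E d
  proof -
    have L: "Lam n E d \<ge> B * real n powr (\<sigma> - 1)"
      and least: "\<tau> * real n \<le> least_eigenvalue (signless_laplacian n E)"
      using that by (auto simp: dense_enough_def expanding_def)
    have Lpos: "Lam n E d > 0"
      using L \<open>B > 0\<close> n by (smt (verit) mult_pos_pos of_nat_0_less_iff powr_gt_zero)
    have "c * norm_inf n (deviation n E d) / (Lam n E d * n) \<le> H"
      unfolding H_def using c K assms n by (intro gamma_scale_le[OF _ _ _ _ _ L X]) auto
    note b = beta_bounds[OF n E \<open>\<tau> > 0\<close> least Lpos this[unfolded c_def], folded c_def, folded M1_def M2_def]
    have "norm_inf n (discrepancy n E d (beta n E d))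
        \<le> M1 * K1\<^sup>2 * (Lam n E d powr (2 * (3/4) - 1) * real n powr (2 * (3/4 - \<sigma>/4) - 1))"
      using n pos by (intro order_trans[OF b(2)] square_bound_scale Lpos X norm_inf_nonneg) auto
    moreover have "norm_1 n (discrepancy n E d (beta n E d))
        \<le> M2 * K2\<^sup>2 * (Lam n E d powr (2 * (1/2) - 1) * real n powr (2 * (1 + \<epsilon>/2) - 1))"
      using n pos by (intro order_trans[OF b(3)] square_bound_scale Lpos X2 norm_2_nonneg) auto
    \<comment> \<open>The factor \<open>\<Lambda> powr 0\<close> in the second bound is 1 because
      \<open>\<Lambda> > 0\<close>.\<close>
    ultimately show ?thesis
      using b Lpos by (simp add: discrepancy_small_def right_diff_distrib)
  qed
  show "\<exists>C>0. \<exists>L1>0. \<exists>L2>0. \<exists>M1>0. \<exists>M2>0.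
      \<forall>\<^sub>F n in sequentially. \<forall>E d.
        simple_graph n E \<and> pos_even_seq n d \<and>
        degrees_bounded n E d \<and> dense_enough \<sigma> B n E d \<and> expanding \<tau> n E d \<and>
        norm_inf n (deviation n E d)
          \<le> K1 * (Lam n E d powr (3/4) * real n powr (3/4 - \<sigma>/4)) \<and>
        norm_2 n (deviation n E d)
          \<le> K2 * (Lam n E d powr (1/2) * real n powr (1 + \<epsilon>/2))
        \<longrightarrow>
        spread_bounded C n (beta n E d) \<and>
        discrepancy_small \<sigma> \<epsilon> L1 L2 n E d (beta n E d) \<and>
        norm_inf n (discrepancy n E d (beta n E d))
          \<le> M1 * (1 / (Lam n E d * real n)) * (norm_inf n (deviation n E d))^2 \<and>
        norm_1 n (discrepancy n E d (beta n E d))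
          \<le> M2 * (1 / (Lam n E d * real n)) * (norm_2 n (deviation n E d))^2"
  proof (intro exI conjI)
    show "\<forall>\<^sub>F n in sequentially. \<forall>E d.
        simple_graph n E \<and> pos_even_seq n d \<and>
        degrees_bounded n E d \<and> dense_enough \<sigma> B n E d \<and> expanding \<tau> n E d \<and>
        norm_inf n (deviation n E d)
          \<le> K1 * (Lam n E d powr (3/4) * real n powr (3/4 - \<sigma>/4)) \<and>
        norm_2 n (deviation n E d)
          \<le> K2 * (Lam n E d powr (1/2) * real n powr (1 + \<epsilon>/2))
        \<longrightarrow>
        spread_bounded (2 * H) n (beta n E d) \<and>
        discrepancy_small \<sigma> \<epsilon> (M1 * K1\<^sup>2) (M2 * K2\<^sup>2) n E d (beta n E d) \<and>
        norm_inf n (discrepancy n E d (beta n E d))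
          \<le> M1 * (1 / (Lam n E d * real n)) * (norm_inf n (deviation n E d))^2 \<and>
        norm_1 n (discrepancy n E d (beta n E d))
          \<le> M2 * (1 / (Lam n E d * real n)) * (norm_2 n (deviation n E d))^2"
      using eventually_gt_at_top[of 0] by eventually_elim (use main in blast)
  qed (use pos in auto)
qed

end
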